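(* Let $p,q$ be nonnegative integers with $q<p$. For $\epsilon\in\mathbb{R}$ let $$N^\epsilon=\Big\{x\in\mathbb{R}^{p,q} : \sum_{i=1}^p x_i\le\epsilon\Big\}.$$ Then for any $\epsilon>0$ the set $N^\epsilon$ is homotopy-equivalent to $N^{-\epsilon}$ with $\binom{p-1}{q}$ cells of dimension $q$ attached. The latter cells are the $q$-dimensional simplices from the collection $$\big\{\mathrm{conv}(e_j,\ j\in J) : J\subset\{1,\ldots,p\},\ 1\in J,\ |J|=q+1\big\}.$$
   Context: $\mathbb{R}^{p,q}=\{x\in\mathbb{R}^p : \|x\|_0\le q\}$, where $\|x\|_0$ is the number of non-zero entries of $x$. The $e_j$ are the coordinate (unit) vectors of $\mathbb{R}^p$, and $\mathrm{conv}(e_j, j\in J)$ is the simplex of convex combinations of the $e_j$, $j\in J$. "$Y$ with $m$ cells of dimension $q$ attached" means a space obtained by gluing $m$ closed $q$-balls (here the listed $q$-dimensional simplices) to $Y$ along continuous maps from their boundary spheres to $Y$; for $q=0$ this is the disjoint union of $Y$ with $m$ points. *)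

theory Defs
  imports "HOL-Analysis.Analysis"
begin

definition zero_norm :: "real ^ 'n \<Rightarrow> nat"
  where "zero_norm x = card {i. x $ i \<noteq> 0}"

definition sparse_vectors :: "nat \<Rightarrow> (real ^ 'n) set"
  where "sparse_vectors q = {x. zero_norm x \<le> q}"

definition sum_sublevel :: "nat \<Rightarrow> real \<Rightarrow> (real ^ 'n) set"
  where "sum_sublevel q \<epsilon> = {x \<in> sparse_vectors q. (\<Sum>i\<in>UNIV. x $ i) \<le> \<epsilon>}"

definition coord_simplices :: "'n \<Rightarrow> nat \<Rightarrow> (real ^ 'n) set set"
  where "coord_simplices i1 q =
    {convex hull ((\<lambda>j. axis j 1) ` J) | J. i1 \<in> J \<and> card J = q + 1}"

text \<open>The finest topology on \<open>f ` topspace X\<close> that makes \<open>f\<close> continuous.\<close>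

definition quotient_topology :: "'a topology \<Rightarrow> ('a \<Rightarrow> 'b) \<Rightarrow> 'b topology"
  where "quotient_topology X f =
    topology (\<lambda>U. U \<subseteq> f ` topspace X \<and> openin X {x \<in> topspace X. f x \<in> U})"

lemma openin_quotient_topology:
  "openin (quotient_topology X f) U \<longleftrightarrow>
     U \<subseteq> f ` topspace X \<and> openin X {x \<in> topspace X. f x \<in> U}"
proof -
  have "{x \<in> topspace X. f x \<in> S \<inter> T} =
      {x \<in> topspace X. f x \<in> S} \<inter> {x \<in> topspace X. f x \<in> T}" for S T
    by auto
  moreover have "{x \<in> topspace X. f x \<in> \<Union> \<K>} = (\<Union>K\<in>\<K>. {x \<in> topspace X. f x \<in> K})" for \<K>
    by auto
  ultimately have "istopology (\<lambda>U. U \<subseteq> f ` topspace X \<and> openin X {x \<in> topspace X. f x \<in> U})"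
    unfolding istopology_def by auto
  then show ?thesis
    by (simp add: quotient_topology_def)
qed

lemma topspace_quotient_topology [simp]: "topspace (quotient_topology X f) = f ` topspace X"
proof -
  have "{x \<in> topspace X. f x \<in> f ` topspace X} = topspace X"
    by auto
  then have "openin (quotient_topology X f) (f ` topspace X)"
    by (simp add: openin_quotient_topology)
  then show ?thesis
    by (metis openin_quotient_topology openin_subset openin_topspace subset_antisym)
qed

lemma quotient_map_quotient_topology: "quotient_map X (quotient_topology X f) f"
  by (auto simp: quotient_map_def openin_quotient_topology)

text \<open>
  The disjoint union of \<open>Y\<close> (tagged \<open>None\<close>) and the cells \<open>C \<in> \<C>\<close> (tagged \<open>Some C\<close>). The gluing
  map sends each point to a representative of its class: a point \<open>x\<close> of the boundary sphere
  \<open>rel_frontier C\<close> goes to its image \<open>\<phi> C x\<close> in \<open>Y\<close>, every other point is kept. For a zero-dimensional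
  cell the boundary is empty.
\<close>

definition cells_sum ::
    "'a::euclidean_space topology \<Rightarrow> 'a set set \<Rightarrow> ('a set option \<times> 'a) topology"
  where "cells_sum Y \<C> =
    sum_topology (\<lambda>k. case k of None \<Rightarrow> Y | Some C \<Rightarrow> top_of_set C) (insert None (Some ` \<C>))"

definition glue_cells ::
    "('a::euclidean_space set \<Rightarrow> 'a \<Rightarrow> 'a) \<Rightarrow> 'a set option \<times> 'a \<Rightarrow> 'a set option \<times> 'a"
  where "glue_cells \<phi> = (\<lambda>(k, x). case k of
      None \<Rightarrow> (None, x)
    | Some C \<Rightarrow> if x \<in> rel_frontier C then (None, \<phi> C x) else (Some C, x))"

definition attach_cells ::
    "'a::euclidean_space topology \<Rightarrow> 'a set set \<Rightarrow> ('a set \<Rightarrow> 'a \<Rightarrow> 'a) \<Rightarrow>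
     ('a set option \<times> 'a) topology"
  where "attach_cells Y \<C> \<phi> = quotient_topology (cells_sum Y \<C>) (glue_cells \<phi>)"

definition attaching_maps ::
    "'a::euclidean_space topology \<Rightarrow> 'a set set \<Rightarrow> ('a set \<Rightarrow> 'a \<Rightarrow> 'a) \<Rightarrow> bool"
  where "attaching_maps Y \<C> \<phi> \<longleftrightarrow>
    (\<forall>C\<in>\<C>. continuous_map (top_of_set (rel_frontier C)) Y (\<phi> C))"

text \<open>
  The fibres of the gluing map are exactly the classes of the equivalence relation generated by
  \<open>x \<sim> \<phi> C x\<close> for \<open>x \<in> rel_frontier C\<close>.
\<close>

lemma glue_cells_eq_iff:
  fixes \<C> :: "'a::euclidean_space set set" and \<phi> :: "'a set \<Rightarrow> 'a \<Rightarrow> 'a"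
  defines "R \<equiv> {((Some C, x), (None, \<phi> C x)) | C x. C \<in> \<C> \<and> x \<in> rel_frontier C}"
  assumes a: "a \<in> topspace (cells_sum Y \<C>)" and b: "b \<in> topspace (cells_sum Y \<C>)"
  shows "glue_cells \<phi> a = glue_cells \<phi> b \<longleftrightarrow> (a, b) \<in> (R \<union> R\<inverse>)\<^sup>*"
proof
  have reach: "(c, glue_cells \<phi> c) \<in> R\<^sup>=" if "c \<in> topspace (cells_sum Y \<C>)" for c
    using that by (auto simp: cells_sum_def glue_cells_def R_def split: option.splits if_splits)
  assume "glue_cells \<phi> a = glue_cells \<phi> b"
  then have "(a, glue_cells \<phi> a) \<in> R\<^sup>=" "(glue_cells \<phi> a, b) \<in> (R\<inverse>)\<^sup>="
    using reach[OF a] reach[OF b] by auto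
  then have "(a, glue_cells \<phi> a) \<in> (R \<union> R\<inverse>)\<^sup>*" "(glue_cells \<phi> a, b) \<in> (R \<union> R\<inverse>)\<^sup>*"
    by auto
  then show "(a, b) \<in> (R \<union> R\<inverse>)\<^sup>*"
    by (rule rtrancl_trans)
next
  assume "(a, b) \<in> (R \<union> R\<inverse>)\<^sup>*"
  then show "glue_cells \<phi> a = glue_cells \<phi> b"
    by (induction rule: rtrancl_induct) (auto simp: R_def glue_cells_def)
qed

end

theory Submission
  imports Defs
begin

text \<open>
  The attaching map is \<open>x \<mapsto> - \<epsilon> x\<close> on every cell, so the attached space is realised inside \<open>\<real>\<^sup>p\<close> as
  the union \<open>X\<close> of \<open>N\<^sup>-\<^sup>\<epsilon>\<close> and the rescaled simplices \<open>- \<epsilon> C\<close>. The set \<open>N\<^sup>\<epsilon>\<close> is starlike about \<open>0\<close>, so it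
  suffices to contract \<open>X\<close>. Let \<open>r\<close> replace \<open>x\<close> by its negative part, normalised to have sum
  \<open>- \<epsilon>\<close>. Since \<open>r\<close> does not enlarge supports, the segment from \<open>x\<close> to \<open>r x\<close> stays in \<open>X\<close>. The image
  of \<open>r\<close> consists of the points of the simplex spanned by all \<open>- \<epsilon> e\<^sub>j\<close> with at most \<open>q\<close> non-zero
  entries besides the first one, and it is starlike about \<open>- \<epsilon> e\<^sub>1\<close>.
\<close>

section \<open>Attaching cells inside a Euclidean space\<close>

text \<open>The map \<open>g\<close>, the inclusion on \<open>Y\<close> and \<open>f\<close> on each
  cell, is a quotient map from the disjoint union onto the union in the ambient space. It identifies
  exactly the points that the gluing identifies, so it descends to an injective quotient map, which
  is a homeomorphism.\<close>

lemma attach_cells_homeomorphic_Un: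
  fixes Y :: "'a::euclidean_space set" and f :: "'a \<Rightarrow> 'a"
  assumes Y: "closed Y" and fin: "finite \<C>" and cpt: "\<And>C. C \<in> \<C> \<Longrightarrow> compact C"
    and cont: "continuous_on UNIV f" and inj: "inj f"
    and bdry: "\<And>C x. \<lbrakk>C \<in> \<C>; x \<in> rel_frontier C\<rbrakk> \<Longrightarrow> f x \<in> Y"
    and int: "\<And>C x. \<lbrakk>C \<in> \<C>; x \<in> C; x \<notin> rel_frontier C\<rbrakk> \<Longrightarrow> f x \<notin> Y"
    and disj: "\<And>C D x. \<lbrakk>C \<in> \<C>; D \<in> \<C>; x \<in> C; x \<in> D; x \<notin> rel_frontier C; x \<notin> rel_frontier D\<rbrakk> \<Longrightarrow> C = D"
  shows "attach_cells (top_of_set Y) \<C> (\<lambda>_. f) homeomorphic_space top_of_set (Y \<union> f ` \<Union>\<C>)"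
proof -
  define Z where "Z = Y \<union> f ` \<Union>\<C>"
  define g where "g = (\<lambda>(k :: 'a set option, x). case k of None \<Rightarrow> x | Some C \<Rightarrow> f x)"
  let ?S = "cells_sum (top_of_set Y) \<C>"
  let ?A = "attach_cells (top_of_set Y) \<C> (\<lambda>_. f)"
  have top: "topspace ?S = {None} \<times> Y \<union> (SIGMA k : Some ` \<C>. the k)"
    by (auto simp: cells_sum_def)
  have img: "g ` topspace ?S = Z"
  proof
    show "g ` topspace ?S \<subseteq> Z"
      unfolding top Z_def g_def by (auto intro!: imageI)
    have "y \<in> g ` topspace ?S" if "y \<in> Y" for y
      using that by (intro image_eqI[of _ _ "(None, y)"]) (auto simp: top g_def)
    moreover have "f x \<in> g ` topspace ?S" if "C \<in> \<C>" "x \<in> C" for C x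
      using that by (intro image_eqI[of _ _ "(Some C, x)"]) (auto simp: top g_def)
    ultimately show "Z \<subseteq> g ` topspace ?S"
      by (auto simp: Z_def)
  qed
  have contf: "continuous_on S f" for S
    using cont continuous_on_subset by blast
  have "continuous_map ?S (top_of_set Z) g"
    unfolding continuous_map_def
  proof (intro conjI allI impI)
    show "g \<in> topspace ?S \<rightarrow> topspace (top_of_set Z)"
      using img by auto
    fix U assume "openin (top_of_set Z) U"
    then obtain T where T: "open T" "U = Z \<inter> T"
      by (auto simp: openin_open)
    have "openin (top_of_set C) {x \<in> C. f x \<in> T}" if "C \<in> \<C>" for C
      using continuous_openin_preimage_gen[OF contf[of C] \<open>open T\<close>] by (simp add: vimage_def Int_def)
    moreover have "openin (top_of_set Y) (Y \<inter> T)"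
      using T by auto
    moreover have "{x. (None, x) \<in> {x \<in> topspace ?S. g x \<in> U}} = Y \<inter> T"
      using T by (auto simp: top g_def Z_def)
    moreover have "{x. (Some C, x) \<in> {x \<in> topspace ?S. g x \<in> U}} = {x \<in> C. f x \<in> T}" if "C \<in> \<C>" for C
      using that T by (auto simp: top g_def Z_def)
    ultimately show "openin ?S {x \<in> topspace ?S. g x \<in> U}"
      by (subst cells_sum_def, subst openin_sum_topology) (auto simp: top)
  qed
  \<comment> \<open>Closedness is where \<open>Y\<close> closed, the cells compact and their number
    finite come in: the image of a closed set is a finite union of sets closed in the whole
    space.\<close>
  moreover have "closed_map ?S (top_of_set Z) g"
    unfolding closed_map_def
  proof (intro allI impI)
    fix U assume U: "closedin ?S U"
    then have sub: "U \<subseteq> topspace ?S"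
      by (rule closedin_subset)
    have N: "closedin (top_of_set Y) {x. (None, x) \<in> U}"
      and C: "\<And>C. C \<in> \<C> \<Longrightarrow> closedin (top_of_set C) {x. (Some C, x) \<in> U}"
      using U unfolding cells_sum_def closedin_sum_topology by auto
    have "closed {x. (None, x) \<in> U}"
      using N Y closedin_closed_trans by blast
    moreover have "closed (f ` {x. (Some C, x) \<in> U})" if "C \<in> \<C>" for C
      using closedin_compact[OF cpt C] that contf compact_continuous_image compact_imp_closed by metis
    moreover have "g ` U = {x. (None, x) \<in> U} \<union> (\<Union>C\<in>\<C>. f ` {x. (Some C, x) \<in> U})"
      using sub unfolding top g_def by (force simp: image_iff)
    ultimately have "closed (g ` U)"
      using fin by auto
    moreover have "g ` U \<subseteq> Z"
      using sub img by auto
    ultimately show "closedin (top_of_set Z) (g ` U)"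
      by (simp add: closed_subset)
  qed
  ultimately have "quotient_map ?S (top_of_set Z) g"
    by (simp add: continuous_closed_quotient_map img)
  \<comment> \<open>Gluing does not change the value of \<open>g\<close>: a boundary point
    \<open>x\<close> becomes \<open>(None, f x)\<close>, and both have value \<open>f x\<close>.
    Hence the map induced on the quotient is \<open>g\<close> itself, applied to
    representatives.\<close>
  then have "quotient_map ?S (top_of_set Z) (g \<circ> glue_cells (\<lambda>_. f))"
    by (rule quotient_map_eq) (auto simp: g_def glue_cells_def split: option.splits)
  then have "quotient_map ?A (top_of_set Z) g"
    unfolding attach_cells_def by (simp add: quotient_map_compose_eq[OF quotient_map_quotient_topology])
  moreover have "inj_on g (topspace ?A)"
  proof (rule inj_onI)
    \<comment> \<open>Each class has a representative in \<open>Y\<close> or in the relative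
      interior of a cell. Then \<open>int\<close> separates the two kinds, while \<open>inj\<close>
      and \<open>disj\<close> separate interior points.\<close>
    have *: "(\<exists>y\<in>Y. a = (None, y)) \<or> (\<exists>C\<in>\<C>. \<exists>x\<in>C. x \<notin> rel_frontier C \<and> a = (Some C, x))"
      if "a \<in> topspace ?A" for a
      using that bdry by (auto simp: attach_cells_def top glue_cells_def split: if_splits)
    fix a b assume "a \<in> topspace ?A" "b \<in> topspace ?A" "g a = g b"
    then show "a = b"
      using *[of a] *[of b] int disj injD[OF inj] by (auto simp: g_def) (metis, metis)
  qed
  ultimately show ?thesis
    unfolding Z_def[symmetric] using homeomorphic_map_def homeomorphic_map_imp_homeomorphic_space by blast
qed

section \<open>Coordinate simplices\<close>

definition coord_simplex :: "'n set \<Rightarrow> (real ^ 'n::finite) set"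
  where "coord_simplex J = convex hull ((\<lambda>j. axis j 1) ` J)"

lemma coord_simplices_eq: "coord_simplices i q = coord_simplex ` {J. i \<in> J \<and> card J = q + 1}"
  by (auto simp: coord_simplices_def coord_simplex_def)

text \<open>The barycentric coordinates of a point are its own entries, so membership becomes a
  condition on entries and support.\<close>

lemma coord_simplex_eq:
  "coord_simplex J = {x. (\<forall>i. 0 \<le> x $ i) \<and> (\<forall>i. i \<notin> J \<longrightarrow> x $ i = 0) \<and> (\<Sum>i\<in>UNIV. x $ i) = 1}"
    (is "_ = ?R")
proof
  have "convex ?R"
    by (auto simp: convex_def sum.distrib simp flip: sum_distrib_left)
  moreover have "(\<lambda>j. axis j 1) ` J \<subseteq> ?R"
    by (auto simp: axis_def)
  ultimately show "coord_simplex J \<subseteq> ?R"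
    unfolding coord_simplex_def by (rule hull_minimal[rotated])
  show "?R \<subseteq> coord_simplex J"
  proof
    fix x assume x: "x \<in> ?R"
    have "(\<Sum>j\<in>UNIV. x $ j) = (\<Sum>j\<in>J. x $ j)"
      using x by (intro sum.mono_neutral_right) auto
    then have "(\<Sum>j\<in>J. x $ j *\<^sub>R axis j 1) \<in> coord_simplex J"
      unfolding coord_simplex_def using x by (intro convex_sum) (auto intro: hull_inc)
    moreover have "(\<Sum>j\<in>J. x $ j *\<^sub>R axis j 1) = (\<Sum>j\<in>UNIV. x $ j *\<^sub>R axis j 1)"
      using x by (intro sum.mono_neutral_left) auto
    moreover have "\<dots> = x"
      by (simp add: vec_eq_iff axis_def if_distrib cong: if_cong)
    ultimately show "x \<in> coord_simplex J"
      by metis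
  qed
qed

lemma not_affine_dependent_axes: "\<not> affine_dependent ((\<lambda>j. axis j (1::real)) ` J)"
proof -
  have "(\<lambda>j. axis j (1::real)) ` J \<subseteq> Basis"
    by (auto simp: Basis_vec_def)
  then show ?thesis
    using affine_dependent_imp_dependent independent_mono[OF independent_Basis] by blast
qed

lemma inj_axis_1: "inj (\<lambda>j. axis j (1::real))"
  by (auto simp: inj_def axis_eq_axis)

text \<open>The vertices are affinely independent, so the relative frontier is the union of the
  facets, each obtained by dropping one vertex, that is, by letting one entry vanish. For a single
  vertex it is empty, as a 0-cell requires.\<close>

lemma rel_frontier_coord_simplex:
  "rel_frontier (coord_simplex J) = {x \<in> coord_simplex J. \<exists>j\<in>J. x $ j = 0}"
proof -
  have *: "(\<lambda>j. axis j (1::real)) ` J - {axis j 1} = (\<lambda>j. axis j 1) ` (J - {j})" for j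
    by (auto simp: axis_eq_axis)
  have "rel_frontier (coord_simplex J) =
      \<Union> ((\<lambda>a. convex hull ((\<lambda>j. axis j 1) ` J - {a})) ` (\<lambda>j. axis j 1) ` J)"
    unfolding coord_simplex_def rel_frontier_convex_hull_cases[OF not_affine_dependent_axes] by blast
  then have "rel_frontier (coord_simplex J) = (\<Union>j\<in>J. coord_simplex (J - {j}))"
    by (simp add: * coord_simplex_def image_image)
  then show ?thesis
    unfolding coord_simplex_eq by auto
qed

text \<open>An interior point determines its simplex. This makes the open cells disjoint and, by
  counting entries, keeps their images out of the sublevel set.\<close>

lemma support_coord_simplex_interior:
  assumes "x \<in> coord_simplex J" "x \<notin> rel_frontier (coord_simplex J)"
  shows "{i. x $ i \<noteq> 0} = J"
proof -
  have "\<forall>j\<in>J. x $ j \<noteq> 0"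
    using assms unfolding rel_frontier_coord_simplex by blast
  then show ?thesis
    using assms(1) unfolding coord_simplex_eq by blast
qed

lemma simplex_coord_simplex: "card J = q + 1 \<Longrightarrow> int q simplex coord_simplex J"
  unfolding coord_simplex_def
  by (intro simplex_convex_hull conjI not_affine_dependent_axes)
    (simp add: card_image inj_on_subset[OF inj_axis_1])

lemma inj_coord_simplex: "inj coord_simplex"
proof (rule injI)
  fix J K :: "'a set" assume eq: "coord_simplex J = coord_simplex K"
  \<comment> \<open>The index set is read off from the unit vectors that the simplex
    contains.\<close>
  have "J = {j. axis j 1 \<in> coord_simplex J}" for J :: "'a set"
    by (auto simp: coord_simplex_eq axis_def)
  then show "J = K"
    using eq by metis
qed

text \<open>With \<open>i1\<close> fixed in \<open>J\<close>, the other \<open>q\<close> indices are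
  chosen freely among the remaining ones.\<close>

lemma card_coord_simplices:
  "card (coord_simplices i q :: (real ^ 'n::finite) set set) = (CARD('n) - 1) choose q"
proof -
  have "bij_betw (insert i) {B. B \<subseteq> UNIV - {i} \<and> card B = q} {J. i \<in> J \<and> card J = q + 1}"
    by (rule bij_betw_byWitness[where f' = "\<lambda>J. J - {i}"]) (auto simp: card_insert_if)
  then have "card {J. i \<in> J \<and> card J = q + 1} = (CARD('n) - 1) choose q"
    by (simp add: n_subsets card_Diff_singleton flip: bij_betw_same_card)
  then show ?thesis
    unfolding coord_simplices_eq by (simp add: card_image inj_on_subset[OF inj_coord_simplex])
qed

section \<open>Sublevel sets\<close>

lemma closed_sum_sublevel: "closed (sum_sublevel q a :: (real ^ 'n::finite) set)"
proof -
  \<comment> \<open>Sparsity is rewritten so that the set becomes a finite union of coordinate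
    subspaces, which is visibly closed.\<close>
  have "zero_norm x \<le> q \<longleftrightarrow> (\<exists>A\<in>{A. card A \<le> q}. \<forall>i\<in>-A. x $ i = 0)" for x :: "real ^ 'n"
  proof
    assume "zero_norm x \<le> q"
    then show "\<exists>A\<in>{A. card A \<le> q}. \<forall>i\<in>-A. x $ i = 0"
      by (intro bexI[of _ "{i. x $ i \<noteq> 0}"]) (auto simp: zero_norm_def)
  next
    assume "\<exists>A\<in>{A. card A \<le> q}. \<forall>i\<in>-A. x $ i = 0"
    then obtain A where A: "card A \<le> q" "\<forall>i\<in>-A. x $ i = 0"
      by auto
    then have "card {i. x $ i \<noteq> 0} \<le> card A"
      by (intro card_mono) auto
    then show "zero_norm x \<le> q"
      using A by (simp add: zero_norm_def)
  qed
  then have "sparse_vectors q = (\<Union>A\<in>{A. card A \<le> q}. \<Inter>i\<in>-A. {x :: real ^ 'n. x $ i = 0})"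
    by (auto simp: sparse_vectors_def)
  moreover have "closed (\<Union>A\<in>{A. card A \<le> q}. \<Inter>i\<in>-A. {x :: real ^ 'n. x $ i = 0})"
    by (intro closed_UN closed_INT ballI closed_Collect_eq continuous_intros) auto
  moreover have "closed {x :: real ^ 'n. (\<Sum>i\<in>UNIV. x $ i) \<le> a}"
    by (intro closed_Collect_le continuous_intros)
  moreover have "sum_sublevel q a = sparse_vectors q \<inter> {x :: real ^ 'n. (\<Sum>i\<in>UNIV. x $ i) \<le> a}"
    by (auto simp: sum_sublevel_def)
  ultimately show ?thesis
    by auto
qed

lemma zero_norm_mono:
  assumes "\<And>i. x $ i = 0 \<Longrightarrow> y $ i = 0"
  shows "zero_norm y \<le> zero_norm x"
  unfolding zero_norm_def using assms by (intro card_mono) auto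

text \<open>Shrinking towards the origin never enlarges the support. Positivity of \<open>a\<close>
  puts the origin in the set and keeps the scaled sum below \<open>a\<close>, even when the sum is
  positive.\<close>

lemma contractible_sum_sublevel:
  fixes a :: real
  assumes "a > 0"
  shows "contractible (sum_sublevel q a :: (real ^ 'n::finite) set)"
proof (rule starlike_imp_contractible)
  show "starlike (sum_sublevel q a :: (real ^ 'n) set)"
    unfolding starlike_def
  proof (intro bexI ballI subsetI)
    show "0 \<in> (sum_sublevel q a :: (real ^ 'n) set)"
      using assms by (simp add: sum_sublevel_def sparse_vectors_def zero_norm_def)
    fix x y :: "real ^ 'n" assume x: "x \<in> sum_sublevel q a" and "y \<in> closed_segment 0 x"
    then obtain u where u: "0 \<le> u" "u \<le> 1" "y = u *\<^sub>R x"
      by (auto simp: closed_segment_def)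
    have "zero_norm y \<le> zero_norm x"
      using u by (intro zero_norm_mono) auto
    moreover have "u * (\<Sum>i\<in>UNIV. x $ i) \<le> a"
    proof -
      have "u * (\<Sum>i\<in>UNIV. x $ i) \<le> u * a"
        using x u by (intro mult_left_mono) (auto simp: sum_sublevel_def)
      also have "\<dots> \<le> 1 * a"
        using u assms by (intro mult_right_mono) auto
      finally show ?thesis
        by simp
    qed
    ultimately show "y \<in> sum_sublevel q a"
      using x u by (simp add: sum_sublevel_def sparse_vectors_def flip: sum_distrib_left)
  qed
qed

section \<open>Contracting the attached space inside Euclidean space\<close>

lemma uminus_scaleR_coord_simplex_eq:
  fixes a :: real
  assumes "a > 0"
  shows "(\<lambda>x. - a *\<^sub>R x) ` coord_simplex J =
    {x. (\<forall>i. x $ i \<le> 0) \<and> (\<forall>i. i \<notin> J \<longrightarrow> x $ i = 0) \<and> (\<Sum>i\<in>UNIV. x $ i) = - a}" (is "?L = ?R")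
proof
  show "?L \<subseteq> ?R"
    using assms by (auto simp: coord_simplex_eq sum_negf simp flip: sum_distrib_left)
  show "?R \<subseteq> ?L"
  proof
    fix x assume x: "x \<in> ?R"
    then have "inverse (- a) *\<^sub>R x \<in> coord_simplex J"
      using assms by (auto simp: coord_simplex_eq sum_negf mult_nonneg_nonpos simp flip: sum_distrib_left)
    moreover have "x = - a *\<^sub>R (inverse (- a) *\<^sub>R x)"
      using assms by simp
    ultimately show "x \<in> ?L"
      by blast
  qed
qed

text \<open>Two straight-line homotopies in \<open>X\<close> are composed. A direct segment to
  \<open>e\<close> could leave \<open>X\<close>, since it may add a non-zero entry to a point with
  positive entries; these are first removed by \<open>r\<close>.\<close>

lemma contractible_sum_sublevel_Un_simplices:
  fixes i1 :: "'n::finite" and \<epsilon> :: real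
  assumes q: "q < CARD('n)" and \<epsilon>: "\<epsilon> > 0"
  defines "X \<equiv> sum_sublevel q (- \<epsilon>) \<union> (\<lambda>x. - \<epsilon> *\<^sub>R x) ` \<Union>(coord_simplices i1 q)"
  shows "contractible X"
proof -
  let ?s = "\<lambda>x :: real ^ 'n. \<Sum>i\<in>UNIV. x $ i"
  let ?m = "\<lambda>x :: real ^ 'n. \<Sum>i\<in>UNIV. min (x $ i) 0"
  define r where "r x = (\<chi> i. - \<epsilon> * min (x $ i) 0 / ?m x)" for x
  \<comment> \<open>Not counting the entry \<open>i1\<close> covers the simplices and the sparse
    points that avoid \<open>i1\<close> by one condition.\<close>
  define K where "K = {x. (\<forall>i. x $ i \<le> 0) \<and> ?s x = - \<epsilon> \<and> card ({i. x $ i \<noteq> 0} - {i1}) \<le> q}"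
  define e where "e = - \<epsilon> *\<^sub>R axis i1 (1::real)"
  have X_iff: "x \<in> X \<longleftrightarrow> (zero_norm x \<le> q \<and> ?s x \<le> - \<epsilon>) \<or>
      (\<exists>J. i1 \<in> J \<and> card J = q + 1 \<and> (\<forall>i. x $ i \<le> 0) \<and> (\<forall>i. i \<notin> J \<longrightarrow> x $ i = 0) \<and> ?s x = - \<epsilon>)" for x
  proof -
    have "X = sum_sublevel q (- \<epsilon>) \<union>
        (\<Union>J\<in>{J. i1 \<in> J \<and> card J = q + 1}. (\<lambda>x. - \<epsilon> *\<^sub>R x) ` coord_simplex J)"
      unfolding X_def coord_simplices_eq by blast
    then show ?thesis
      unfolding uminus_scaleR_coord_simplex_eq[OF \<epsilon>] by (auto simp: sum_sublevel_def sparse_vectors_def)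
  qed
  have KX: "x \<in> X" if x: "x \<in> K" for x
  proof (cases "x $ i1 = 0")
    case True
    then have "{i. x $ i \<noteq> 0} - {i1} = {i. x $ i \<noteq> 0}"
      by auto
    then show ?thesis
      using x by (simp add: X_iff K_def zero_norm_def)
  next
    case False
    then have "card {i. x $ i \<noteq> 0} \<le> q + 1"
      using x by (simp add: K_def card_Diff_singleton le_diff_conv)
    \<comment> \<open>The support has at most \<open>q + 1\<close> elements, and
      \<open>q < CARD('n)\<close> leaves room to enlarge it to exactly that size.\<close>
    then obtain J where "{i. x $ i \<noteq> 0} \<subseteq> J" "card J = q + 1"
      using exists_subset_between[of "{i. x $ i \<noteq> 0}" "q + 1" UNIV] q by auto
    then show ?thesis
      using x False by (auto simp: X_iff K_def intro!: exI[of _ J])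
  qed
  \<comment> \<open>The denominator of \<open>r\<close> stays away from 0 on \<open>X\<close>, which
    gives its continuity and signs.\<close>
  have m_le: "?m x \<le> - \<epsilon>" if "x \<in> X" for x
  proof -
    have "?m x \<le> ?s x"
      by (intro sum_mono) auto
    then show ?thesis
      using that by (auto simp: X_iff)
  qed
  have sum_r: "?s (r x) = - \<epsilon>" if "x \<in> X" for x
  proof -
    have "?s (r x) = - \<epsilon> / ?m x * ?m x"
      by (simp only: r_def vec_lambda_beta sum_distrib_left times_divide_eq_left)
    then show ?thesis
      using m_le[OF that] \<epsilon> by simp
  qed
  have r_nonpos: "r x $ i \<le> 0" if "x \<in> X" for x i
  proof -
    have "\<epsilon> * min (x $ i) 0 \<le> 0"
      using \<epsilon> by (simp add: mult_nonneg_nonpos)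
    then have "0 \<le> \<epsilon> * min (x $ i) 0 / ?m x"
      using m_le[OF that] \<epsilon> by (intro divide_nonpos_nonpos) auto
    then show ?thesis
      by (simp add: r_def)
  qed
  have r_support: "r x $ i = 0" if "x $ i = 0" for x i
    using that by (simp add: r_def)
  have rK: "r x \<in> K" if x: "x \<in> X" for x
  proof -
    have "card ({i. x $ i \<noteq> 0} - {i1}) \<le> q"
      using x unfolding X_iff
    proof (elim disjE conjE exE)
      assume "zero_norm x \<le> q"
      then show ?thesis
        unfolding zero_norm_def by (meson Diff_subset card_mono finite le_trans)
    next
      fix J assume J: "i1 \<in> J" "card J = q + 1" "\<forall>i. i \<notin> J \<longrightarrow> x $ i = 0"
      then have "card ({i. x $ i \<noteq> 0} - {i1}) \<le> card (J - {i1})"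
        by (intro card_mono) auto
      then show ?thesis
        using J by simp
    qed
    moreover have "card ({i. r x $ i \<noteq> 0} - {i1}) \<le> card ({i. x $ i \<noteq> 0} - {i1})"
      using r_support by (intro card_mono) auto
    ultimately show ?thesis
      using x by (simp add: K_def sum_r r_nonpos)
  qed
  have segX: "(1 - u) *\<^sub>R x + u *\<^sub>R r x \<in> X" (is "?y \<in> X") if x: "x \<in> X" and u: "0 \<le> u" "u \<le> 1" for x u
  proof -
    have s: "?s ?y = (1 - u) * ?s x + u * (- \<epsilon>)"
      using sum_r[OF x] by (simp add: sum.distrib flip: sum_distrib_left)
    show ?thesis
      using x unfolding X_iff[of x]
    proof (elim disjE conjE exE)
      assume "zero_norm x \<le> q" "?s x \<le> - \<epsilon>"
      moreover have "zero_norm ?y \<le> zero_norm x"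
        using r_support by (intro zero_norm_mono) auto
      moreover have "(1 - u) * ?s x + u * (- \<epsilon>) \<le> - \<epsilon>"
        using \<open>?s x \<le> - \<epsilon>\<close> u by (intro convex_bound_le) auto
      ultimately show ?thesis
        unfolding X_iff s by auto
    next
      fix J assume J: "i1 \<in> J" "card J = q + 1" "\<forall>i. x $ i \<le> 0" "\<forall>i. i \<notin> J \<longrightarrow> x $ i = 0" "?s x = - \<epsilon>"
      have "?m x = ?s x"
        using J by (intro sum.cong) auto
      \<comment> \<open>On a simplex there is no positive entry to remove and the sum is already
        \<open>- \<epsilon>\<close>, so the homotopy is constant there.\<close>
      then have "r x = x"
        using J \<epsilon> by (auto simp: r_def vec_eq_iff min_def intro: order_antisym)
      then have "?y = x"
        by (simp flip: scaleR_left_distrib)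
      then show ?thesis
        using x by simp
    qed
  qed
  have segK: "(1 - u) *\<^sub>R x + u *\<^sub>R e \<in> K" (is "?y \<in> K") if x: "x \<in> K" and u: "0 \<le> u" "u \<le> 1" for x u
  proof -
    have "?s e = - \<epsilon>"
      by (simp add: e_def axis_def if_distrib sum_negf cong: if_cong)
    moreover have "?s ?y = (1 - u) * ?s x + u * ?s e"
      by (simp add: sum.distrib flip: sum_distrib_left)
    ultimately have "?s ?y = - \<epsilon>"
      using x by (simp add: K_def algebra_simps)
    moreover have "?y $ i \<le> 0" for i
    proof -
      have "e $ i \<le> 0"
        using \<epsilon> by (simp add: e_def axis_def)
      then show ?thesis
        using x u by (simp add: K_def add_nonpos_nonpos mult_nonneg_nonpos)
    qed
    \<comment> \<open>Moving towards \<open>e\<close> can create a non-zero entry only at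
      \<open>i1\<close>, the index that \<open>K\<close> does not count.\<close>
    moreover have "card ({i. ?y $ i \<noteq> 0} - {i1}) \<le> card ({i. x $ i \<noteq> 0} - {i1})"
      by (intro card_mono) (auto simp: e_def axis_def)
    ultimately show ?thesis
      using x by (simp add: K_def)
  qed
  have "?m x \<noteq> 0" if "x \<in> X" for x
    using m_le[OF that] \<epsilon> by linarith
  then have contr: "continuous_on X r"
    unfolding r_def by (intro continuous_intros) auto
  have "homotopic_with_canon (\<lambda>_. True) X X id r"
    by (rule homotopic_with_linear) (auto simp: closed_segment_def segX contr)
  moreover have "homotopic_with_canon (\<lambda>_. True) X X r (\<lambda>_. e)"
    by (rule homotopic_with_linear) (auto simp: closed_segment_def contr intro: KX segK rK)
  ultimately show ?thesis
    unfolding contractible_def using homotopic_with_trans by blast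
qed

section \<open>Attaching along the scaling map and comparing homotopy types\<close>

theorem lemma1:
  fixes p q :: nat and \<epsilon> :: real and i1 :: "'n::finite"
  assumes "CARD('n) = p" and "q < p" and "\<epsilon> > 0"
  shows "card (coord_simplices i1 q :: (real ^ 'n) set set) = (p - 1) choose q
    \<and> (\<forall>C \<in> (coord_simplices i1 q :: (real ^ 'n) set set). int q simplex C)
    \<and> (\<exists>\<phi>. attaching_maps (top_of_set (sum_sublevel q (- \<epsilon>))) (coord_simplices i1 q) \<phi>
         \<and> top_of_set (sum_sublevel q \<epsilon> :: (real ^ 'n) set) homotopy_equivalent_space
             attach_cells (top_of_set (sum_sublevel q (- \<epsilon>))) (coord_simplices i1 q) \<phi>)"
proof -
  let ?N = "sum_sublevel q (- \<epsilon>) :: (real ^ 'n) set"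
  let ?\<C> = "coord_simplices i1 q :: (real ^ 'n) set set"
  let ?f = "\<lambda>x :: real ^ 'n. - \<epsilon> *\<^sub>R x"
  let ?X = "?N \<union> ?f ` \<Union>?\<C>"
  have simplex: "int q simplex C" if "C \<in> ?\<C>" for C
    using that simplex_coord_simplex by (auto simp: coord_simplices_eq)
  have zero_norm_f: "zero_norm (?f x) = zero_norm x" for x
    using assms by (simp add: zero_norm_def)
  have bdry: "?f x \<in> ?N" if C: "C \<in> ?\<C>" and x: "x \<in> rel_frontier C" for C x
  proof -
    obtain J where J: "card J = q + 1" "C = coord_simplex J"
      using C by (auto simp: coord_simplices_eq)
    then obtain j where j: "j \<in> J" "x $ j = 0" "x \<in> coord_simplex J"
      using x by (auto simp: rel_frontier_coord_simplex)
    \<comment> \<open>A boundary point lacks one of the \<open>q + 1\<close> possible entries, so it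
      is sparse enough; scaling turns its sum 1 into exactly \<open>- \<epsilon>\<close>.\<close>
    then have "zero_norm x \<le> card (J - {j})"
      unfolding zero_norm_def by (intro card_mono) (auto simp: coord_simplex_eq)
    then have "zero_norm x \<le> q"
      using J j by simp
    then show ?thesis
      using j zero_norm_f
      by (simp add: sum_sublevel_def sparse_vectors_def coord_simplex_eq sum_negf flip: sum_distrib_left)
  qed
  have "attach_cells (top_of_set ?N) ?\<C> (\<lambda>_. ?f) homeomorphic_space top_of_set ?X"
  proof (rule attach_cells_homeomorphic_Un)
    show "closed ?N"
      by (rule closed_sum_sublevel)
    show "finite ?\<C>"
      by (simp add: coord_simplices_eq)
    show "compact C" if "C \<in> ?\<C>" for C
      using simplex[OF that] by (rule compact_simplex)
    show "continuous_on UNIV ?f"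
      by (intro continuous_intros)
    show "inj ?f"
      using assms by (auto simp: inj_def)
    show "?f x \<in> ?N" if "C \<in> ?\<C>" "x \<in> rel_frontier C" for C x
      using bdry that .
    show "?f x \<notin> ?N" if C: "C \<in> ?\<C>" and x: "x \<in> C" "x \<notin> rel_frontier C" for C x
    proof -
      obtain J where "card J = q + 1" "C = coord_simplex J"
        using C by (auto simp: coord_simplices_eq)
      then have "zero_norm x = q + 1"
        using support_coord_simplex_interior[of x J] x by (simp add: zero_norm_def)
      then show ?thesis
        using zero_norm_f by (simp add: sum_sublevel_def sparse_vectors_def)
    qed
    show "C = D" if "C \<in> ?\<C>" "D \<in> ?\<C>" "x \<in> C" "x \<in> D" "x \<notin> rel_frontier C" "x \<notin> rel_frontier D" for C D x
      using that support_coord_simplex_interior unfolding coord_simplices_eq by blast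
  qed
  moreover have "(sum_sublevel q \<epsilon> :: (real ^ 'n) set) homotopy_eqv ?X"
  proof (rule homotopy_eqv_contractible_sets)
    show "contractible (sum_sublevel q \<epsilon> :: (real ^ 'n) set)"
      using assms by (intro contractible_sum_sublevel)
    show "contractible ?X"
      using assms by (intro contractible_sum_sublevel_Un_simplices) auto
    have "0 \<in> (sum_sublevel q \<epsilon> :: (real ^ 'n) set)"
      using assms by (simp add: sum_sublevel_def sparse_vectors_def zero_norm_def)
    \<comment> \<open>Contractible sets may be empty, so both sides need a point. For
      \<open>q = 0\<close> the set \<open>?N\<close> is empty and only the cells supply one; they
      exist because \<open>q < p\<close> makes the binomial coefficient non-zero.\<close>
    moreover have "?\<C> \<noteq> {}"
    proof -
      have "card ?\<C> \<noteq> 0"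
        using assms by (simp add: card_coord_simplices)
      then show ?thesis
        by auto
    qed
    then obtain C where "C \<in> ?\<C>"
      by auto
    moreover from this have "C \<noteq> {}"
      using simplex[of C] by (auto simp: simplex_def)
    ultimately show "sum_sublevel q \<epsilon> = ({} :: (real ^ 'n) set) \<longleftrightarrow> ?X = {}"
      by blast
  qed
  ultimately have "top_of_set (sum_sublevel q \<epsilon> :: (real ^ 'n) set) homotopy_equivalent_space
      attach_cells (top_of_set ?N) ?\<C> (\<lambda>_. ?f)"
    by (meson homeomorphic_imp_homotopy_equivalent_space homeomorphic_space_sym homotopy_eqv_trans)
  moreover have "attaching_maps (top_of_set ?N) ?\<C> (\<lambda>_. ?f)"
    unfolding attaching_maps_def continuous_map_in_subtopology
    using bdry by (auto intro!: continuous_intros)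
  moreover have "card ?\<C> = (p - 1) choose q"
    using assms by (simp add: card_coord_simplices)
  ultimately show ?thesis
    using simplex by (intro conjI ballI exI)
qed

end
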